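(* Let $b,\mu,p\in\mathbb{R}$ and let $t>0$ satisfy $t\neq-\frac1p$, i.e. $\tau:=pt+1\neq0$. Then the measure generated at time $t$ by the Prandtl spiral with parameters $b,\mu,p$ belongs locally to $H^{-1}(\mathbb{R}^2)$.
   Context: Identify $\mathbb{R}^2$ with $\mathbb{C}$. The Prandtl spiral with real parameters $b,\mu,p$ at time $t>0$ is the curve, parametrized by the cumulated vorticity $\Gamma\in\mathbb{R}\setminus\{0\}$, $$z_P(\Gamma,t)=\begin{cases}\tau^q\,\Gamma^{\nu} & \text{if }\Gamma>0,\\ -\tau^q\,|\Gamma|^{\nu} & \text{if }\Gamma<0,\end{cases}\qquad \nu=\tfrac12+ib,\quad q=\tfrac12+ib\mu,\quad \tau=pt+1,$$ where for $x>0$ and $w\in\mathbb{C}$ one sets $x^{w}=e^{w\log x}$ (if $\tau<0$, $\tau^q$ is understood with a fixed branch of the logarithm). The measure generated by the spiral is the signed Radon measure on $\mathbb{R}^2$ supported on the curve for which $\Gamma$ is the cumulated vorticity: for bounded Borel $A\subset\mathbb{R}^2$ it assigns to $A$ the value $$\mathcal{L}^1(\{\Gamma>0: z_P(\Gamma,t)\in A\})-\mathcal{L}^1(\{\Gamma<0: z_P(\Gamma,t)\in A\}),$$ where $\mathcal{L}^1$ is Lebesgue measure on $\mathbb{R}$; thus the branch $\Gamma>0$ carries the positive part and the branch $\Gamma<0$ the negative part. A measure belongs locally to $H^{-1}(\mathbb{R}^2)$ if for every $R_0>0$ its restriction to the ball $B(0,R_0)$ belongs to $H^{-1}(\mathbb{R}^2)$.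 A tempered distribution $f$ on $\mathbb{R}^2$ belongs to $H^{-1}(\mathbb{R}^2)$ if its Fourier transform $\hat f$ is a (locally integrable) function and $\int_{\mathbb{R}^2}(1+|\xi|^2)^{-1}|\hat f(\xi)|^2\,d\xi<\infty$. A finite signed Borel measure is identified with the tempered distribution it defines. *)

theory Defs
  imports "HOL-Analysis.Analysis"
begin

fun iter_partial :: "'a::euclidean_space list \<Rightarrow> ('a \<Rightarrow> complex) \<Rightarrow> 'a \<Rightarrow> complex" where
  "iter_partial [] f = f"
| "iter_partial (v # vs) f = (\<lambda>x. frechet_derivative (iter_partial vs f) (at x) v)"

text \<open>Differentiability is over the reals (Frechet). A function all of whose iterated partial
  derivatives, of any order and in any succession of coordinate directions, are differentiable
  everywhere is exactly a function of class C-infinity.\<close>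

definition smooth :: "('a::euclidean_space \<Rightarrow> complex) \<Rightarrow> bool" where
  "smooth f \<longleftrightarrow> (\<forall>vs. set vs \<subseteq> Basis \<longrightarrow> iter_partial vs f differentiable_on UNIV)"

definition schwartz :: "('a::euclidean_space \<Rightarrow> complex) set" where
  "schwartz = {f. smooth f \<and> (\<forall>k vs. set vs \<subseteq> Basis \<longrightarrow>
     bdd_above (range (\<lambda>x. norm x ^ k * norm (iter_partial vs f x))))}"

definition schwartz_seminorm :: "nat \<Rightarrow> 'a::euclidean_space list \<Rightarrow> ('a \<Rightarrow> complex) \<Rightarrow> real" where
  "schwartz_seminorm k vs f = (SUP x. norm x ^ k * norm (iter_partial vs f x))"

definition test_functions :: "('a::euclidean_space \<Rightarrow> complex) set" where
  "test_functions = {f. smooth f \<and> compact (closure {x. f x \<noteq> 0})}"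

text \<open>A distribution is a functional on all functions of which only the values on Schwartz
  functions matter. Continuity is expressed through the seminorms defining the topology of the
  Schwartz space.\<close>

definition tempered_distribution :: "(('a::euclidean_space \<Rightarrow> complex) \<Rightarrow> complex) \<Rightarrow> bool" where
  "tempered_distribution T \<longleftrightarrow>
     (\<forall>f\<in>schwartz. \<forall>g\<in>schwartz. T (\<lambda>x. f x + g x) = T f + T g) \<and>
     (\<forall>c. \<forall>f\<in>schwartz. T (\<lambda>x. c * f x) = c * T f) \<and>
     (\<exists>C N. \<forall>f\<in>schwartz. norm (T f) \<le>
        C * (\<Sum>k\<le>N. \<Sum>vs\<in>{vs. set vs \<subseteq> Basis \<and> length vs \<le> N}. schwartz_seminorm k vs f))"

definition fourier :: "('a::euclidean_space \<Rightarrow> complex) \<Rightarrow> 'a \<Rightarrow> complex" where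
  "fourier f \<xi> = (\<integral>x. exp (- \<i> * complex_of_real (x \<bullet> \<xi>)) * f x \<partial>lborel)"

definition fourier_dist ::
    "(('a::euclidean_space \<Rightarrow> complex) \<Rightarrow> complex) \<Rightarrow> ('a \<Rightarrow> complex) \<Rightarrow> complex" where
  "fourier_dist T f = T (fourier f)"

definition locally_integrable :: "('a::euclidean_space \<Rightarrow> complex) \<Rightarrow> bool" where
  "locally_integrable g \<longleftrightarrow> (\<forall>K. compact K \<longrightarrow> set_integrable lborel K g)"

text \<open>The product of a locally integrable function with a Schwartz function need not be
  integrable, so the equality of a tempered distribution with a function is tested on compactly
  supported smooth functions (which are dense in the Schwartz space).\<close>

definition dist_is_function ::
    "(('a::euclidean_space \<Rightarrow> complex) \<Rightarrow> complex) \<Rightarrow> ('a \<Rightarrow> complex) \<Rightarrow> bool" where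
  "dist_is_function T g \<longleftrightarrow> locally_integrable g \<and>
     (\<forall>f\<in>test_functions. T f = (\<integral>x. g x * f x \<partial>lborel))"

definition H_minus_1 :: "(('a::euclidean_space \<Rightarrow> complex) \<Rightarrow> complex) set" where
  "H_minus_1 = {T. tempered_distribution T \<and>
     (\<exists>g. dist_is_function (fourier_dist T) g \<and>
        (\<integral>\<^sup>+\<xi>. ennreal ((norm (g \<xi>))\<^sup>2 / (1 + (norm \<xi>)\<^sup>2)) \<partial>lborel) < \<infinity>)}"

text \<open>Signed measures are set functions; only their values on Borel sets matter.\<close>

definition finite_signed_measure :: "('a::topological_space set \<Rightarrow> real) \<Rightarrow> bool" where
  "finite_signed_measure m \<longleftrightarrow>
     (\<forall>A :: nat \<Rightarrow> 'a set. range A \<subseteq> sets borel \<and> disjoint_family A \<longrightarrow>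
        (\<lambda>i. m (A i)) sums m (\<Union>i. A i))"

definition difference_of_measures ::
    "('a::topological_space set \<Rightarrow> real) \<Rightarrow> 'a measure \<Rightarrow> 'a measure \<Rightarrow> bool" where
  "difference_of_measures m P N \<longleftrightarrow>
     finite_measure P \<and> finite_measure N \<and> sets P = sets borel \<and> sets N = sets borel \<and>
     (\<forall>A\<in>sets borel. m A = measure P A - measure N A)"

text \<open>The integral against a finite signed measure. By the Jordan decomposition theorem a
  decomposition exists, and by the lemma below the value does not depend on it.\<close>

definition signed_integral ::
    "('a::topological_space set \<Rightarrow> real) \<Rightarrow> ('a \<Rightarrow> complex) \<Rightarrow> complex" where
  "signed_integral m f = (THE I. \<exists>P N. difference_of_measures m P N \<and>
     integrable P f \<and> integrable N f \<and> I = (\<integral>x. f x \<partial>P) - (\<integral>x. f x \<partial>N))"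

lemma nn_integral_sum_measures_eq:
  assumes sets: "sets Q = sets P" "sets R = sets P" "sets S = sets P"
    and eq: "\<And>A. A \<in> sets P \<Longrightarrow> emeasure P A + emeasure Q A = emeasure R A + emeasure S A"
    and f: "f \<in> borel_measurable P"
  shows "nn_integral P f + nn_integral Q f = nn_integral R f + nn_integral S f"
proof -
  note meas = measurable_cong_sets[OF sets(1) refl] measurable_cong_sets[OF sets(2) refl]
    measurable_cong_sets[OF sets(3) refl]
  note sp = sets_eq_imp_space_eq[OF sets(1)] sets_eq_imp_space_eq[OF sets(2)]
    sets_eq_imp_space_eq[OF sets(3)]
  show ?thesis
    using f
  proof (induction rule: borel_measurable_induct)
    case (cong f g)
    then show ?case
      using sp by (simp cong: nn_integral_cong_simp)
  next
    case (set A)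
    then show ?case
      using sets eq by simp
  next
    case (mult u c)
    then show ?case
      by (simp add: nn_integral_cmult meas flip: distrib_left)
  next
    case (add u v)
    then have "nn_integral P u + nn_integral Q u + (nn_integral P v + nn_integral Q v) =
        nn_integral R u + nn_integral S u + (nn_integral R v + nn_integral S v)"
      by simp
    with add show ?case
      by (simp add: nn_integral_add meas ac_simps)
  next
    case (seq U)
    have inc: "incseq (\<lambda>i. nn_integral M (U i))" for M :: "'a measure"
      using seq by (auto simp: incseq_def le_fun_def intro!: nn_integral_mono)
    have sup: "nn_integral M (Sup (range U)) = (SUP i. nn_integral M (U i))"
      if "sets M = sets P" for M :: "'a measure"
    proof -
      have "U i \<in> borel_measurable M" for i
        using seq(1)[of i] measurable_cong_sets[OF that refl, of borel] by blast
      with nn_integral_monotone_convergence_SUP[OF seq(3), of M] show ?thesis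
        by (simp add: SUP_apply[abs_def] image_comp)
    qed
    show ?case
      unfolding sup[OF refl] sup[OF sets(1)] sup[OF sets(2)] sup[OF sets(3)]
      by (simp only: ennreal_SUP_add[OF inc inc, symmetric] seq)
  qed
qed

lemma integral_sum_measures_eq_real:
  fixes f :: "'a \<Rightarrow> real"
  assumes sets: "sets Q = sets P" "sets R = sets P" "sets S = sets P"
    and eq: "\<And>A. A \<in> sets P \<Longrightarrow> emeasure P A + emeasure Q A = emeasure R A + emeasure S A"
    and int: "integrable P f" "integrable Q f" "integrable R f" "integrable S f"
  shows "integral\<^sup>L P f + integral\<^sup>L Q f = integral\<^sup>L R f + integral\<^sup>L S f"
proof -
  have *: "enn2real (nn_integral P (\<lambda>x. ennreal (g x))) + enn2real (nn_integral Q (\<lambda>x. ennreal (g x)))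
      = enn2real (nn_integral R (\<lambda>x. ennreal (g x))) + enn2real (nn_integral S (\<lambda>x. ennreal (g x)))"
    if int: "integrable P g" "integrable Q g" "integrable R g" "integrable S g" for g :: "'a \<Rightarrow> real"
  proof -
    have fin: "nn_integral M (\<lambda>x. ennreal (g x)) < top" if "integrable M g" for M
      using that by (simp add: real_integrable_def less_top)
    have "(\<lambda>x. ennreal (g x)) \<in> borel_measurable P"
      using int(1) by auto
    from nn_integral_sum_measures_eq[OF sets eq this] show ?thesis
      using fin[OF int(1)] fin[OF int(2)] fin[OF int(3)] fin[OF int(4)]
      by (simp flip: enn2real_plus)
  qed
  show ?thesis
    using *[OF int] *[of "\<lambda>x. - f x"] int by (simp add: real_lebesgue_integral_def)
qed

lemma signed_integral_eq:
  assumes dec: "difference_of_measures m P N" and int: "integrable P f" "integrable N f"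
  shows "signed_integral m f = (\<integral>x. f x \<partial>P) - (\<integral>x. f x \<partial>N)"
  unfolding signed_integral_def
proof (rule the_equality)
  fix I
  assume "\<exists>P N. difference_of_measures m P N \<and>
     integrable P f \<and> integrable N f \<and> I = (\<integral>x. f x \<partial>P) - (\<integral>x. f x \<partial>N)"
  then obtain P' N' where dec': "difference_of_measures m P' N'"
    and int': "integrable P' f" "integrable N' f"
    and I: "I = (\<integral>x. f x \<partial>P') - (\<integral>x. f x \<partial>N')"
    by blast
  have sets: "sets N' = sets P" "sets P' = sets P" "sets N = sets P"
    using dec dec' by (auto simp: difference_of_measures_def)
  have eq: "emeasure P A + emeasure N' A = emeasure P' A + emeasure N A" if "A \<in> sets P" for A
  proof -
    have "measure P A + measure N' A = measure P' A + measure N A"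
    proof -
      have "m A = measure P A - measure N A" "m A = measure P' A - measure N' A"
        using dec dec' that by (auto simp: difference_of_measures_def)
      then show ?thesis by linarith
    qed
    moreover have "emeasure M A = ennreal (measure M A)" if "M \<in> {P, N, P', N'}" for M
      using dec dec' that
      by (auto simp: difference_of_measures_def intro!: finite_measure.emeasure_eq_measure)
    ultimately show ?thesis
      by (simp flip: ennreal_plus)
  qed
  have eqs: "(\<integral>x. g x \<partial>P) + (\<integral>x. g x \<partial>N') = (\<integral>x. g x \<partial>P') + (\<integral>x. g x \<partial>N)"
    if "integrable P g" "integrable N' g" "integrable P' g" "integrable N g" for g :: "'a \<Rightarrow> real"
    using integral_sum_measures_eq_real[OF sets eq that] .
  have "Re I = Re ((\<integral>x. f x \<partial>P) - (\<integral>x. f x \<partial>N))"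
    using eqs[of "\<lambda>x. Re (f x)"] int int' I by simp
  moreover have "Im I = Im ((\<integral>x. f x \<partial>P) - (\<integral>x. f x \<partial>N))"
    using eqs[of "\<lambda>x. Im (f x)"] int int' I by simp
  ultimately show "I = (\<integral>x. f x \<partial>P) - (\<integral>x. f x \<partial>N)"
    by (rule complex_eqI)
qed (use assms in blast)

text \<open>Local membership is meant for set functions, such as signed Radon measures, which are
  meaningful on bounded Borel sets; the restriction to a ball is a finite signed measure.\<close>

definition locally_H_minus_1 :: "('a::euclidean_space set \<Rightarrow> real) \<Rightarrow> bool" where
  "locally_H_minus_1 m \<longleftrightarrow> (\<forall>R>0.
     finite_signed_measure (\<lambda>A. m (A \<inter> ball 0 R)) \<and>
     signed_integral (\<lambda>A. m (A \<inter> ball 0 R)) \<in> H_minus_1)"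

text \<open>The real logarithm for positive arguments; on the negative half-line the integer k selects
  one of the continuous branches of the complex logarithm (k = 0 is the principal one).\<close>

definition log_branch :: "int \<Rightarrow> real \<Rightarrow> complex" where
  "log_branch k x = (if x > 0 then complex_of_real (ln x)
     else complex_of_real (ln \<bar>x\<bar>) + \<i> * complex_of_real ((2 * of_int k + 1) * pi))"

definition prandtl_spiral :: "int \<Rightarrow> real \<Rightarrow> real \<Rightarrow> real \<Rightarrow> real \<Rightarrow> real \<Rightarrow> complex" where
  "prandtl_spiral k b \<mu> p t \<Gamma> =
     (let \<nu> = 1/2 + \<i> * complex_of_real b;
          q = 1/2 + \<i> * complex_of_real (b * \<mu>);
          \<tau> = p * t + 1;
          \<tau>q = exp (q * log_branch k \<tau>)
      in if \<Gamma> > 0 then \<tau>q * complex_of_real \<Gamma> powr \<nu>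
         else - \<tau>q * complex_of_real \<bar>\<Gamma>\<bar> powr \<nu>)"

text \<open>Only the values on bounded Borel sets are meaningful: on unbounded sets the two lengths may
  be infinite, and then the library function \<^const>\<open>measure\<close> returns 0.\<close>

definition prandtl_measure ::
    "int \<Rightarrow> real \<Rightarrow> real \<Rightarrow> real \<Rightarrow> real \<Rightarrow> complex set \<Rightarrow> real" where
  "prandtl_measure k b \<mu> p t A =
     measure lborel {\<Gamma>. \<Gamma> > 0 \<and> prandtl_spiral k b \<mu> p t \<Gamma> \<in> A} -
     measure lborel {\<Gamma>. \<Gamma> < 0 \<and> prandtl_spiral k b \<mu> p t \<Gamma> \<in> A}"

end

theory Submission
  imports Defs "HOL-Probability.Probability" "HOL-Real_Asymp.Real_Asymp"
begin

text \<open>Inside a ball the measure is the difference of the pushforwards of Lebesgue measure on two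
  bounded sets of parameters, one per branch, and each of the two is already in $H^{-1}$. For a
  finite measure $P$ the identity $1/(1+|\xi|^2) = \int_0^\infty 2u\,e^{-u^2(1+|\xi|^2)}\,du$ and the
  Fourier transform of a Gaussian turn the $H^{-1}$ norm of $P$ into the integral over $u$ of
  $2u\,e^{-u^2}(\sqrt\pi/u)^d$ times $\int\int e^{-|x-y|^2/4u^2}\,dP\,dP$, which converges as soon as
  this double integral is $O(u^{d-1})$. Along one branch $|z(\Gamma)| = c\sqrt{|\Gamma|}$, whatever the
  rotation of the spiral, so on bounded sets
  $|z(\Gamma)-z(\Gamma')| \ge c\,|\sqrt{|\Gamma|}-\sqrt{|\Gamma'|}| \ge \kappa|\Gamma-\Gamma'|$, and a
  one-dimensional Gaussian integral bounds the double integral by a multiple of $u$.\<close>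

section \<open>Fourier transform of a Gaussian, on the line and in Euclidean space\<close>

lemma gaussian_fourier_real:
  fixes u w :: real
  assumes "u > 0"
  shows "has_bochner_integral lborel (\<lambda>x. exp (- \<i> * of_real (x * w)) * of_real (exp (- (u * x)\<^sup>2)))
           (complex_of_real (sqrt pi / u * exp (- (w / (2 * u))\<^sup>2)))"
proof -
  \<comment> \<open>The input is the characteristic function of the standard normal law.
    Substituting \<open>sqrt 2 * u * x\<close> for its variable y turns e^{-y^2/2} into e^{-(ux)^2},
    and with this t the phase t y becomes -xw.\<close>
  define t where "t = - w / (sqrt 2 * u)"
  define f :: "real \<Rightarrow> complex" where "f x = std_normal_density x *\<^sub>R iexp (t * x)" for x
  have "integrable lborel f"
    unfolding f_def
    by (rule Bochner_Integration.integrable_bound[OF integrable_normal_density[of 1 0]]) auto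
  moreover have "integral\<^sup>L lborel f = complex_of_real (exp (- (t^2) / 2))"
  proof -
    have "char std_normal_distribution t = integral\<^sup>L lborel f"
      unfolding char_def f_def by (subst integral_density) auto
    then show ?thesis
      by (simp add: char_std_normal_distribution)
  qed
  ultimately have "has_bochner_integral lborel f (complex_of_real (exp (- (t^2) / 2)))"
    by (simp add: has_bochner_integral_iff)
  then have "has_bochner_integral lborel (\<lambda>x. f (0 + (sqrt 2 * u) * x))
      (complex_of_real (exp (- (t^2) / 2)) /\<^sub>R \<bar>sqrt 2 * u\<bar>)"
    using assms by (subst (asm) lborel_has_bochner_integral_real_affine_iff[where c="sqrt 2 * u" and t=0]) auto
  then have "has_bochner_integral lborel (\<lambda>x. complex_of_real (sqrt (2 * pi)) * f (0 + (sqrt 2 * u) * x))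
      (complex_of_real (sqrt (2 * pi)) * (complex_of_real (exp (- (t^2) / 2)) /\<^sub>R \<bar>sqrt 2 * u\<bar>))"
    by (intro has_bochner_integral_mult_right) auto
  moreover have "complex_of_real (sqrt (2 * pi)) * f (0 + (sqrt 2 * u) * x) =
      exp (- \<i> * of_real (x * w)) * of_real (exp (- (u * x)\<^sup>2))" for x
  proof -
    have 1: "t * (sqrt 2 * u * x) = - (x * w)"
      using assms by (simp add: t_def)
    have 2: "(sqrt 2 * u * x)\<^sup>2 / 2 = (u * x)\<^sup>2"
      by (simp add: power_mult_distrib)
    show ?thesis
      unfolding f_def std_normal_density_def add_0_left 1 minus_divide_left[symmetric] 2
      by (simp add: scaleR_conv_of_real real_sqrt_mult)
  qed
  moreover have "complex_of_real (sqrt (2 * pi)) * (complex_of_real (exp (- (t^2) / 2)) /\<^sub>R \<bar>sqrt 2 * u\<bar>) =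
      complex_of_real (sqrt pi / u * exp (- (w / (2 * u))\<^sup>2))"
  proof -
    have "t^2 / 2 = (w / (2 * u))\<^sup>2"
      by (simp add: t_def power_divide power_mult_distrib)
    then show ?thesis
      using assms by (simp add: scaleR_conv_of_real real_sqrt_mult abs_mult field_simps)
  qed
  ultimately show ?thesis
    by (simp only:)
qed

text \<open>Inner product and squared norm are sums over \<open>Basis\<close>, so the integrand is a
  product of functions of one coordinate each, and the integral over the product measure is the
  product of the one-dimensional ones.\<close>

lemma gaussian_fourier:
  fixes w :: "'a::euclidean_space"
  assumes "u > 0"
  shows "has_bochner_integral lborel
           (\<lambda>x. exp (- \<i> * of_real (w \<bullet> x)) * of_real (exp (- (u * norm x)\<^sup>2)))
           (complex_of_real ((sqrt pi / u) ^ DIM('a) * exp (- (norm w / (2 * u))\<^sup>2)))"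
proof -
  define f where "f b x = exp (- \<i> * of_real (x * (w \<bullet> b))) * complex_of_real (exp (- (u * x)\<^sup>2))"
    for b :: 'a and x :: real
  have f: "has_bochner_integral lborel (f b) (complex_of_real (sqrt pi / u * exp (- ((w \<bullet> b) / (2 * u))\<^sup>2)))" for b
    unfolding f_def using gaussian_fourier_real[OF assms] .
  have prod: "exp (- \<i> * of_real (w \<bullet> x)) * of_real (exp (- (u * norm x)\<^sup>2)) = (\<Prod>b\<in>Basis. f b (x \<bullet> b))" for x
  proof -
    have "- (\<i> * of_real (w \<bullet> x)) = (\<Sum>b\<in>Basis. - (\<i> * of_real ((x \<bullet> b) * (w \<bullet> b))))"
      by (subst euclidean_inner) (simp add: sum_distrib_left sum_negf mult_ac)
    moreover have "- (u * norm x)\<^sup>2 = (\<Sum>b\<in>Basis. - (u * (x \<bullet> b))\<^sup>2)"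
      unfolding power_mult_distrib power2_norm_eq_inner euclidean_inner[of x x]
      by (simp add: sum_negf sum_distrib_left power2_eq_square)
    ultimately show ?thesis
      by (simp add: f_def prod.distrib exp_sum del: exp_of_real)
  qed
  interpret product_sigma_finite "\<lambda>_::'a. lborel :: real measure" ..
  have int: "integrable (\<Pi>\<^sub>M b\<in>Basis. lborel) (\<lambda>y. \<Prod>b\<in>Basis. f b (y b))"
    by (rule product_integrable_prod) (use f in \<open>auto simp: has_bochner_integral_iff\<close>)
  have "(\<integral>y. (\<Prod>b\<in>Basis. f b (y b)) \<partial>(\<Pi>\<^sub>M b\<in>Basis. lborel)) = (\<Prod>b\<in>Basis. integral\<^sup>L lborel (f b))"
    by (rule product_integral_prod) (use f in \<open>auto simp: has_bochner_integral_iff\<close>)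
  also have "\<dots> = (\<Prod>b\<in>Basis. complex_of_real (sqrt pi / u * exp (- ((w \<bullet> b) / (2 * u))\<^sup>2)))"
    by (intro prod.cong refl has_bochner_integral_integral_eq f)
  also have "\<dots> = of_real ((sqrt pi / u) ^ DIM('a) * exp (- (norm w / (2 * u))\<^sup>2))"
  proof -
    have "- (norm w / (2 * u))\<^sup>2 = (\<Sum>b\<in>Basis. - ((w \<bullet> b) / (2 * u))\<^sup>2)"
      unfolding power_divide power2_norm_eq_inner euclidean_inner[of w w]
      by (simp add: sum_divide_distrib sum_negf power2_eq_square)
    then show ?thesis
      by (simp only: of_real_prod[symmetric] prod.distrib prod_constant exp_sum finite_Basis)
  qed
  finally have val: "(\<integral>y. (\<Prod>b\<in>Basis. f b (y b)) \<partial>(\<Pi>\<^sub>M b\<in>Basis. lborel)) = \<dots>" .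
  have [measurable]: "f b \<in> borel_measurable borel" for b
    unfolding f_def by measurable
  \<comment> \<open>\<open>lborel_eq\<close> presents \<open>lborel\<close> as the image of the
    product measure under y \<mapsto> \<Sum> y c * c. The b-th coordinate of that sum is y b, so the
    integrand pulls back to the product just integrated.\<close>
  have inner: "(\<Sum>c\<in>Basis. y c *\<^sub>R c) \<bullet> b = y b" if "b \<in> Basis" for y :: "'a \<Rightarrow> real" and b
    using that by (simp add: inner_sum_left inner_Basis if_distrib cong: if_cong)
  have meas: "(\<lambda>x::'a. \<Prod>b\<in>Basis. f b (x \<bullet> b)) \<in> borel_measurable borel"
    by measurable
  show ?thesis
    unfolding prod has_bochner_integral_iff
    using int val
    by (subst (1 2) lborel_eq) (auto simp: integrable_distr_eq integral_distr meas inner cong: prod.cong)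
qed

section \<open>Fourier transform of a finite measure\<close>

definition fourier_measure :: "'a::euclidean_space measure \<Rightarrow> 'a \<Rightarrow> complex" where
  "fourier_measure P \<xi> = (\<integral>x. exp (- \<i> * of_real (x \<bullet> \<xi>)) \<partial>P)"

lemma borel_measurable_fourier_measure:
  assumes "finite_measure P" and sets: "sets P = sets (borel :: 'a::euclidean_space measure)"
  shows "fourier_measure P \<in> borel_measurable borel"
proof -
  interpret finite_measure P by fact
  note [measurable_cong] = sets
  show ?thesis
    unfolding fourier_measure_def by measurable
qed

lemma norm_fourier_measure_le:
  assumes "finite_measure P" and sets: "sets P = sets (borel :: 'a::euclidean_space measure)"
  shows "norm (fourier_measure P \<xi>) \<le> measure P UNIV"
proof -
  interpret finite_measure P by fact
  note [measurable_cong] = sets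
  have sp: "space P = UNIV" using sets_eq_imp_space_eq[OF sets] by simp
  have "norm (fourier_measure P \<xi>) \<le> (\<integral>x. norm (exp (- \<i> * complex_of_real (x \<bullet> \<xi>))) \<partial>P)"
    unfolding fourier_measure_def by (rule integral_norm_bound)
  then show ?thesis by (simp add: sp norm_exp_eq_Re)
qed

text \<open>The phase has modulus 1 and P is finite, so the double integrand is integrable and
  Fubini applies. This identifies the distributional Fourier transform of P with the bounded
  function \<open>fourier_measure P\<close>.\<close>

lemma integral_fourier:
  fixes f :: "'a::euclidean_space \<Rightarrow> complex"
  assumes "finite_measure P" and sets: "sets P = sets borel" and f: "integrable lborel f"
  shows "integrable P (fourier f)"
    and "integral\<^sup>L P (fourier f) = (\<integral>x. fourier_measure P x * f x \<partial>lborel)"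
proof -
  interpret finite_measure P by fact
  interpret pair_sigma_finite P lborel ..
  note [measurable_cong] = sets
  have [measurable]: "f \<in> borel_measurable borel"
    using f by auto
  have int: "integrable (P \<Otimes>\<^sub>M lborel) (\<lambda>(\<xi>, x). exp (- \<i> * of_real (x \<bullet> \<xi>)) * f x)"
    by (rule Fubini_integrable) (auto simp: norm_mult norm_exp_eq_Re intro!: Bochner_Integration.integrable_bound[OF f])
  show "integrable P (fourier f)"
    using integrable_fst'[OF int] by (simp add: fourier_def[abs_def])
  have "integral\<^sup>L P (fourier f) = (\<integral>x. \<integral>\<xi>. exp (- \<i> * of_real (x \<bullet> \<xi>)) * f x \<partial>P \<partial>lborel)"
    unfolding fourier_def by (rule Fubini_integral[OF int, symmetric])
  then show "integral\<^sup>L P (fourier f) = (\<integral>x. fourier_measure P x * f x \<partial>lborel)"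
    by (simp add: fourier_measure_def inner_commute)
qed


section \<open>From Gaussian means of the transform to the weighted integral in
  \<open>H_minus_1\<close>\<close>

lemma nn_integral_fourier_measure_gaussian:
  assumes "finite_measure P" and sets: "sets P = sets (borel :: 'a::euclidean_space measure)"
    and u: "u > 0"
  shows "(\<integral>\<^sup>+\<xi>. ennreal ((norm (fourier_measure P \<xi>))\<^sup>2 * exp (- (u * norm \<xi>)\<^sup>2)) \<partial>lborel) =
    ennreal ((sqrt pi / u) ^ DIM('a)) *
      (\<integral>\<^sup>+x. \<integral>\<^sup>+y. ennreal (exp (- (dist x y / (2 * u))\<^sup>2)) \<partial>P \<partial>P)"
proof -
  interpret P: finite_measure P by fact
  interpret PP: pair_sigma_finite P P ..
  interpret Q: finite_measure "P \<Otimes>\<^sub>M P"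
    by (intro finite_measure_pair_measure P.finite_measure_axioms)
  interpret Q: pair_sigma_finite "P \<Otimes>\<^sub>M P" "lborel :: 'a measure" ..
  note [measurable_cong] = sets
  define e where "e x \<xi> = exp (- \<i> * of_real (x \<bullet> \<xi>))" for x \<xi> :: 'a
  define G where "G \<xi> = exp (- (u * norm \<xi>)\<^sup>2)" for \<xi> :: 'a
  define K where "K p = exp (- (norm (fst p - snd p) / (2 * u))\<^sup>2)" for p :: "'a \<times> 'a"
  define c where "c = (sqrt pi / u) ^ DIM('a)"
  have [measurable]: "(\<lambda>(x, y). e x y) \<in> borel_measurable (borel \<Otimes>\<^sub>M borel)" "G \<in> borel_measurable borel"
    "K \<in> borel_measurable (borel \<Otimes>\<^sub>M borel)"
    unfolding e_def[abs_def] G_def[abs_def] K_def[abs_def] by measurable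
  have norm_e: "norm (e x \<xi>) = 1" for x \<xi>
    by (simp add: e_def norm_exp_eq_Re)
  have gauss: "has_bochner_integral lborel (\<lambda>\<xi>. e w \<xi> * of_real (G \<xi>))
      (complex_of_real (c * exp (- (norm w / (2 * u))\<^sup>2)))" for w
    unfolding e_def G_def c_def using gaussian_fourier[OF u] .
  have "integrable lborel (\<lambda>\<xi>. e 0 \<xi> * of_real (G \<xi>))"
    using gauss by (simp add: has_bochner_integral_iff)
  then have intG: "integrable lborel G"
    by (simp add: e_def complex_of_real_integrable_eq)
  \<comment> \<open>The transform times its conjugate is a double integral, and e(x, \<xi>) times
    the conjugate of e(y, \<xi>) is e(x - y, \<xi>). Hence the frequency \<xi> meets only the
    difference x - y, to which the Gaussian formula applies.\<close>
  have square: "complex_of_real ((norm (fourier_measure P \<xi>))\<^sup>2) = (\<integral>p. e (fst p - snd p) \<xi> \<partial>(P \<Otimes>\<^sub>M P))" for \<xi>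
  proof -
    have prod: "e (x - y) \<xi> = e x \<xi> * cnj (e y \<xi>)" for x y
      by (simp add: e_def exp_cnj inner_diff_left algebra_simps flip: exp_add)
    have "integrable (P \<Otimes>\<^sub>M P) (\<lambda>(x, y). e (x - y) \<xi>)"
      by (rule Q.integrable_const_bound[where B=1]) (auto simp: norm_e)
    from PP.integral_fst'[OF this]
    have "(\<integral>p. e (fst p - snd p) \<xi> \<partial>(P \<Otimes>\<^sub>M P)) = (\<integral>x. \<integral>y. e x \<xi> * cnj (e y \<xi>) \<partial>P \<partial>P)"
      by (simp add: case_prod_unfold prod)
    also have "\<dots> = (\<integral>x. e x \<xi> \<partial>P) * cnj (\<integral>y. e y \<xi> \<partial>P)"
      by (simp add: integral_cnj)
    also have "\<dots> = complex_of_real ((norm (fourier_measure P \<xi>))\<^sup>2)"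
      by (simp only: fourier_measure_def e_def complex_norm_square)
    finally show ?thesis ..
  qed
  \<comment> \<open>In modulus the integrand is G(\<xi>), integrable in \<xi>, and the product of P
    with itself is finite; the Gaussian weight is what allows the exchange of integrals.\<close>
  have int: "integrable ((P \<Otimes>\<^sub>M P) \<Otimes>\<^sub>M lborel) (\<lambda>(p, \<xi>). e (fst p - snd p) \<xi> * of_real (G \<xi>))"
    by (rule Q.Fubini_integrable)
      (use gauss in \<open>auto simp: norm_mult norm_e has_bochner_integral_iff\<close>)
  have "(\<integral>\<xi>. complex_of_real ((norm (fourier_measure P \<xi>))\<^sup>2 * G \<xi>) \<partial>lborel) =
      (\<integral>\<xi>. \<integral>p. e (fst p - snd p) \<xi> * of_real (G \<xi>) \<partial>(P \<Otimes>\<^sub>M P) \<partial>lborel)"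
    by (simp only: of_real_mult square integral_mult_left_zero)
  also have "\<dots> = (\<integral>p. \<integral>\<xi>. e (fst p - snd p) \<xi> * of_real (G \<xi>) \<partial>lborel \<partial>(P \<Otimes>\<^sub>M P))"
    by (rule Q.Fubini_integral[OF int])
  also have "\<dots> = (\<integral>p. complex_of_real (c * K p) \<partial>(P \<Otimes>\<^sub>M P))"
    unfolding K_def by (intro Bochner_Integration.integral_cong refl has_bochner_integral_integral_eq gauss)
  finally have eq: "(\<integral>\<xi>. (norm (fourier_measure P \<xi>))\<^sup>2 * G \<xi> \<partial>lborel) = (\<integral>p. c * K p \<partial>(P \<Otimes>\<^sub>M P))"
    by (simp only: integral_complex_of_real of_real_eq_iff)
  have [measurable]: "fourier_measure P \<in> borel_measurable borel"
    using borel_measurable_fourier_measure[OF assms(1) sets] .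
  have K: "0 \<le> K p" "K p \<le> 1" for p
    by (auto simp: K_def)
  have "c \<ge> 0"
    using u by (simp add: c_def)
  \<comment> \<open>The exchange involves oscillating integrands and so uses Bochner integrals,
    which are 0 by default for non-integrable functions. Integrability of both final integrands
    carries the equality over to \<open>nn_integral\<close>.\<close>
  have intK: "integrable (P \<Otimes>\<^sub>M P) (\<lambda>p. c * K p)"
    by (intro integrable_mult_right Q.integrable_const_bound[where B=1]) (auto simp: K)
  have intF: "integrable lborel (\<lambda>\<xi>. (norm (fourier_measure P \<xi>))\<^sup>2 * G \<xi>)"
  proof (rule Bochner_Integration.integrable_bound)
    show "integrable lborel (\<lambda>\<xi>. (measure P UNIV)\<^sup>2 * G \<xi>)"
      using intG by simp
    show "AE \<xi> in lborel. norm ((norm (fourier_measure P \<xi>))\<^sup>2 * G \<xi>) \<le> norm ((measure P UNIV)\<^sup>2 * G \<xi>)"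
      using norm_fourier_measure_le[OF assms(1) sets]
      by (auto simp: G_def abs_mult intro!: power_mono)
  qed measurable
  have "(\<integral>\<^sup>+\<xi>. ennreal ((norm (fourier_measure P \<xi>))\<^sup>2 * G \<xi>) \<partial>lborel) =
      (\<integral>\<^sup>+p. ennreal (c * K p) \<partial>(P \<Otimes>\<^sub>M P))"
    by (subst (1 2) nn_integral_eq_integral) (use intK intF eq K \<open>c \<ge> 0\<close> in \<open>auto simp: G_def\<close>)
  also have "\<dots> = ennreal c * (\<integral>\<^sup>+p. ennreal (K p) \<partial>(P \<Otimes>\<^sub>M P))"
    using \<open>c \<ge> 0\<close> K by (simp add: ennreal_mult nn_integral_cmult)
  also have "(\<integral>\<^sup>+p. ennreal (K p) \<partial>(P \<Otimes>\<^sub>M P)) = (\<integral>\<^sup>+x. \<integral>\<^sup>+y. ennreal (K (x, y)) \<partial>P \<partial>P)"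
    by (rule P.nn_integral_fst[symmetric]) measurable
  finally show ?thesis
    by (simp add: G_def K_def c_def dist_norm)
qed

text \<open>Applied with a = 1 + |\<xi>|^2, it writes the weight of \<open>H_minus_1\<close> as a
  superposition of Gaussians. The integrand is the derivative of -e^{-u^2 a}/a.\<close>

lemma nn_integral_inverse_gaussian:
  fixes a :: real
  assumes "a > 0"
  shows "(\<integral>\<^sup>+u. ennreal (2 * u * exp (- (u\<^sup>2 * a))) * indicator {0..} u \<partial>lborel) = ennreal (1 / a)"
proof -
  have "(\<integral>\<^sup>+u. ennreal (2 * u * exp (- (u\<^sup>2 * a))) * indicator {0..} u \<partial>lborel) =
      ennreal (0 - (- exp (- (0\<^sup>2 * a)) / a))"
  proof (rule nn_integral_FTC_atLeast)
    show "((\<lambda>u. - exp (- (u\<^sup>2 * a)) / a) \<longlongrightarrow> 0) at_top"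
      using assms by real_asymp
  qed (use assms in \<open>auto intro!: derivative_eq_intros\<close>)
  then show ?thesis by simp
qed

text \<open>The exponent is the one for which 2u (sqrt pi / u)^d u^(d-1) is constant in u, so that
  only the factor e^{-u^2} remains to be integrated. In the plane it asks for O(u), the behaviour of
  a measure of dimension one.\<close>

definition gaussian_energy_bounded :: "'a::euclidean_space measure \<Rightarrow> bool" where
  "gaussian_energy_bounded P \<longleftrightarrow> (\<exists>C\<ge>0. \<forall>u>0.
     (\<integral>\<^sup>+x. \<integral>\<^sup>+y. ennreal (exp (- (dist x y / (2 * u))\<^sup>2)) \<partial>P \<partial>P) \<le> ennreal (C * u ^ (DIM('a) - 1)))"

lemma fourier_measure_H_minus_1:
  assumes "finite_measure P" and sets: "sets P = sets (borel :: 'a::euclidean_space measure)"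
    and "gaussian_energy_bounded P"
  shows "(\<integral>\<^sup>+\<xi>. ennreal ((norm (fourier_measure P \<xi>))\<^sup>2 / (1 + (norm \<xi>)\<^sup>2)) \<partial>lborel) < \<infinity>"
proof -
  obtain C where "C \<ge> 0" and C: "\<And>u. u > 0 \<Longrightarrow>
      (\<integral>\<^sup>+x. \<integral>\<^sup>+y. ennreal (exp (- (dist x y / (2 * u))\<^sup>2)) \<partial>P \<partial>P) \<le> ennreal (C * u ^ (DIM('a) - 1))"
    using assms(3) by (auto simp: gaussian_energy_bounded_def)
  define h where "h \<xi> = (norm (fourier_measure P \<xi>))\<^sup>2" for \<xi>
  define c where "c = 2 * C * sqrt pi ^ DIM('a)"
  have [measurable]: "h \<in> borel_measurable borel"
    unfolding h_def[abs_def] using borel_measurable_fourier_measure[OF assms(1) sets] by measurable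
  have h: "h \<xi> \<ge> 0" for \<xi>
    by (simp add: h_def)
  have "(\<integral>\<^sup>+\<xi>. ennreal (h \<xi> / (1 + (norm \<xi>)\<^sup>2)) \<partial>lborel) =
    (\<integral>\<^sup>+\<xi>. \<integral>\<^sup>+u. ennreal (h \<xi>) * (ennreal (2 * u * exp (- (u\<^sup>2 * (1 + (norm \<xi>)\<^sup>2)))) * indicator {0..} u) \<partial>lborel \<partial>lborel)"
  proof (rule nn_integral_cong)
    fix \<xi> :: 'a
    have pos: "1 + (norm \<xi>)\<^sup>2 > 0"
      by (simp add: add_pos_nonneg)
    show "ennreal (h \<xi> / (1 + (norm \<xi>)\<^sup>2)) =
      (\<integral>\<^sup>+u. ennreal (h \<xi>) * (ennreal (2 * u * exp (- (u\<^sup>2 * (1 + (norm \<xi>)\<^sup>2)))) * indicator {0..} u) \<partial>lborel)"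
      using nn_integral_inverse_gaussian[OF pos] h pos
      by (simp add: nn_integral_cmult flip: ennreal_mult)
  qed
  also have "\<dots> = (\<integral>\<^sup>+u. \<integral>\<^sup>+\<xi>. ennreal (h \<xi>) * (ennreal (2 * u * exp (- (u\<^sup>2 * (1 + (norm \<xi>)\<^sup>2)))) * indicator {0..} u) \<partial>lborel \<partial>lborel)"
    by (rule lborel_pair.Fubini'[symmetric]) measurable
  also have "\<dots> \<le> (\<integral>\<^sup>+u. ennreal (c * exp (- u\<^sup>2)) \<partial>lborel)"
  proof (rule nn_integral_mono)
    fix u :: real
    show "(\<integral>\<^sup>+\<xi>. ennreal (h \<xi>) * (ennreal (2 * u * exp (- (u\<^sup>2 * (1 + (norm \<xi>)\<^sup>2)))) * indicator {0..} u) \<partial>lborel)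
       \<le> ennreal (c * exp (- u\<^sup>2))"
    proof (cases "u > 0")
      case True
      have "(\<integral>\<^sup>+\<xi>. ennreal (h \<xi>) * (ennreal (2 * u * exp (- (u\<^sup>2 * (1 + (norm \<xi>)\<^sup>2)))) * indicator {0..} u) \<partial>lborel)
        = (\<integral>\<^sup>+\<xi>. ennreal (2 * u * exp (- u\<^sup>2)) * ennreal (h \<xi> * exp (- (u * norm \<xi>)\<^sup>2)) \<partial>lborel)"
        using True h
        by (intro nn_integral_cong)
          (simp add: algebra_simps power_mult_distrib exp_add exp_diff exp_minus divide_simps flip: ennreal_mult)
      also have "\<dots> = ennreal (2 * u * exp (- u\<^sup>2)) * (\<integral>\<^sup>+\<xi>. ennreal (h \<xi> * exp (- (u * norm \<xi>)\<^sup>2)) \<partial>lborel)"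
        by (rule nn_integral_cmult) measurable
      also have "\<dots> \<le> ennreal (2 * u * exp (- u\<^sup>2)) *
          (ennreal ((sqrt pi / u) ^ DIM('a)) * ennreal (C * u ^ (DIM('a) - 1)))"
        unfolding h_def nn_integral_fourier_measure_gaussian[OF assms(1) sets True]
        by (intro mult_left_mono C True) auto
      also have "\<dots> = ennreal (2 * u * exp (- u\<^sup>2) * ((sqrt pi / u) ^ DIM('a) * (C * u ^ (DIM('a) - 1))))"
        using True \<open>C \<ge> 0\<close> by (simp add: ennreal_mult)
      also have "2 * u * exp (- u\<^sup>2) * ((sqrt pi / u) ^ DIM('a) * (C * u ^ (DIM('a) - 1))) = c * exp (- u\<^sup>2)"
        using True power_minus_mult[of "DIM('a)" u, symmetric]
        by (simp add: c_def power_divide)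
      finally show ?thesis .
    next
      case False
      \<comment> \<open>For u < 0 the indicator vanishes and for u = 0 the factor 2u does, so the
        left side is 0 and the bound may be integrated over the whole line.\<close>
      then have "u < 0 \<or> u = 0" by auto
      then show ?thesis by auto
    qed
  qed
  also have "\<dots> < \<infinity>"
  proof -
    have "integrable lborel (\<lambda>u::real. c * exp (- u\<^sup>2))"
      using gaussian_fourier_real[of 1 0]
      by (auto simp: has_bochner_integral_iff complex_of_real_integrable_eq)
    moreover have "c \<ge> 0"
      using \<open>C \<ge> 0\<close> by (simp add: c_def)
    ultimately show ?thesis
      by (subst nn_integral_eq_integral) auto
  qed
  finally show ?thesis
    by (simp add: h_def)
qed

section \<open>Gaussian energy of a measure carried by a plane curve\<close>

lemma gaussian_energy_bounded_distr:
  fixes z :: "real \<Rightarrow> 'a::euclidean_space"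
  assumes dim: "DIM('a) = 2" and z: "z \<in> borel_measurable borel" and "S \<in> sets borel"
    and fin: "emeasure lborel S < \<infinity>" and "\<kappa> > 0"
    and expand: "\<And>x y. x \<in> S \<Longrightarrow> y \<in> S \<Longrightarrow> \<kappa> * \<bar>x - y\<bar> \<le> dist (z x) (z y)"
  shows "gaussian_energy_bounded (distr (density lborel (indicator S)) borel z)"
proof -
  note [measurable] = z \<open>S \<in> sets borel\<close>
  \<comment> \<open>The inner integral will be at most sqrt pi / v with v = \<kappa> / (2u),
    uniformly in x, and the outer one contributes the length of S; the product is C u, which is the
    required power of u because d - 1 = 1.\<close>
  define C where "C = measure lborel S * (sqrt pi * 2 / \<kappa>)"
  have "(\<integral>\<^sup>+x. \<integral>\<^sup>+y. ennreal (exp (- (dist x y / (2 * u))\<^sup>2)) \<partial>(distr (density lborel (indicator S)) borel z)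
      \<partial>(distr (density lborel (indicator S)) borel z)) \<le> ennreal (C * u)" if "u > 0" for u
  proof -
    define v where "v = \<kappa> / (2 * u)"
    have v: "v > 0"
      using \<open>\<kappa> > 0\<close> \<open>u > 0\<close> by (simp add: v_def)
    have gauss: "(\<integral>\<^sup>+y. ennreal (exp (- (v * (y - x))\<^sup>2)) \<partial>lborel) = ennreal (sqrt pi / v)" for x
    proof -
      have "has_bochner_integral lborel (\<lambda>y. complex_of_real (exp (- (v * y)\<^sup>2))) (complex_of_real (sqrt pi / v))"
        using gaussian_fourier_real[OF v, of 0] by simp
      then have "has_bochner_integral lborel (\<lambda>y. exp (- (v * y)\<^sup>2)) (sqrt pi / v)"
        by (simp only: has_bochner_integral_iff complex_of_real_integrable_eq
          integral_complex_of_real of_real_eq_iff)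
      then have "has_bochner_integral lborel (\<lambda>y. exp (- (v * (y - x))\<^sup>2)) (sqrt pi / v)"
        by (subst (asm) lborel_has_bochner_integral_real_affine_iff[where c=1 and t="-x"]) auto
      then show ?thesis
        by (simp add: has_bochner_integral_iff nn_integral_eq_integral)
    qed
    have "(\<integral>\<^sup>+x. \<integral>\<^sup>+y. ennreal (exp (- (dist x y / (2 * u))\<^sup>2)) \<partial>(distr (density lborel (indicator S)) borel z)
      \<partial>(distr (density lborel (indicator S)) borel z)) =
      (\<integral>\<^sup>+x. indicator S x * (\<integral>\<^sup>+y. indicator S y * ennreal (exp (- (dist (z x) (z y) / (2 * u))\<^sup>2)) \<partial>lborel) \<partial>lborel)"
      by (simp add: nn_integral_distr nn_integral_density)
    \<comment> \<open>Expansion replaces the distance of the image points by \<kappa> |x - y|, which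
      only increases the Gaussian; S is then enlarged to the whole line in the inner integral, where
      translation invariance removes x.\<close>
    also have "\<dots> \<le> (\<integral>\<^sup>+x. indicator S x * ennreal (sqrt pi / v) \<partial>lborel)"
    proof (rule nn_integral_mono)
      fix x
      have "(\<integral>\<^sup>+y. indicator S y * ennreal (exp (- (dist (z x) (z y) / (2 * u))\<^sup>2)) \<partial>lborel) \<le>
          (\<integral>\<^sup>+y. ennreal (exp (- (v * (y - x))\<^sup>2)) \<partial>lborel)" if "x \<in> S"
      proof (intro nn_integral_mono)
        fix y
        have "(v * (y - x))\<^sup>2 \<le> (dist (z x) (z y) / (2 * u))\<^sup>2" if "y \<in> S"
        proof -
          have "\<bar>v * (y - x)\<bar> \<le> dist (z x) (z y) / (2 * u)"
            using expand[OF \<open>x \<in> S\<close> \<open>y \<in> S\<close>] \<open>u > 0\<close> \<open>\<kappa> > 0\<close>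
            by (simp add: v_def abs_mult abs_minus_commute divide_right_mono)
          then show ?thesis
            by (metis abs_le_square_iff abs_ge_zero abs_of_nonneg order_trans)
        qed
        then show "indicator S y * ennreal (exp (- (dist (z x) (z y) / (2 * u))\<^sup>2)) \<le> ennreal (exp (- (v * (y - x))\<^sup>2))"
          by (auto simp: indicator_def intro!: ennreal_leI)
      qed
      then show "indicator S x * (\<integral>\<^sup>+y. indicator S y * ennreal (exp (- (dist (z x) (z y) / (2 * u))\<^sup>2)) \<partial>lborel)
        \<le> indicator S x * ennreal (sqrt pi / v)"
        unfolding gauss by (auto simp: indicator_def)
    qed
    also have "\<dots> = ennreal (measure lborel S) * ennreal (sqrt pi / v)"
      using fin by (simp add: nn_integral_multc emeasure_eq_ennreal_measure less_top)
    also have "\<dots> = ennreal (measure lborel S * (sqrt pi / v))"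
      using v by (intro ennreal_mult[symmetric]) auto
    also have "measure lborel S * (sqrt pi / v) = C * u"
      by (simp add: C_def v_def)
    finally show ?thesis .
  qed
  moreover have "C \<ge> 0"
    using \<open>\<kappa> > 0\<close> by (simp add: C_def)
  ultimately show ?thesis
    using dim by (auto simp: gaussian_energy_bounded_def)
qed


section \<open>Signed measures as tempered distributions, and their membership in
  \<open>H_minus_1\<close>\<close>

lemma difference_of_measures_imp_finite_signed_measure:
  assumes "difference_of_measures m P N"
  shows "finite_signed_measure m"
  unfolding finite_signed_measure_def
proof (intro allI impI, elim conjE)
  fix A :: "nat \<Rightarrow> 'a set"
  assume A: "range A \<subseteq> sets borel" "disjoint_family A"
  have sums: "(\<lambda>i. measure M (A i)) sums measure M (\<Union>i. A i)"
    if "finite_measure M" "sets M = sets borel" for M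
    using finite_measure.finite_measure_UNION[OF that(1), of A] A that(2) by simp
  have "(\<lambda>i. measure P (A i) - measure N (A i)) sums (measure P (\<Union>i. A i) - measure N (\<Union>i. A i))"
    using assms by (intro sums_diff sums) (auto simp: difference_of_measures_def)
  moreover have "m B = measure P B - measure N B" if "B \<in> sets borel" for B
    using assms that by (auto simp: difference_of_measures_def)
  moreover have "A i \<in> sets borel" for i
    using A by auto
  ultimately show "(\<lambda>i. m (A i)) sums m (\<Union>i. A i)"
    by (simp add: sets.countable_UN)
qed

lemma smooth_imp_continuous_on:
  assumes "smooth f"
  shows "continuous_on UNIV f"
proof -
  have "iter_partial [] f differentiable_on UNIV"
    using assms unfolding smooth_def by (metis empty_set empty_subsetI)
  then show ?thesis
    by (simp add: differentiable_imp_continuous_on)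
qed

lemma test_function_integrable:
  assumes "f \<in> test_functions"
  shows "integrable lborel f"
proof -
  let ?K = "closure {x. f x \<noteq> 0}"
  have "continuous_on UNIV f" and K: "compact ?K"
    using assms by (auto simp: test_functions_def smooth_imp_continuous_on)
  then have "set_integrable lborel ?K f"
    unfolding set_integrable_def by (intro borel_integrable_compact) (auto intro: continuous_on_subset)
  moreover have "indicator ?K x *\<^sub>R f x = f x" for x
    using closure_subset[of "{x. f x \<noteq> 0}"] by (cases "f x = 0") (auto simp: indicator_def)
  ultimately show ?thesis
    by (simp add: set_integrable_def)
qed

lemma norm_le_schwartz_seminorm:
  assumes "f \<in> schwartz"
  shows "norm (f x) \<le> schwartz_seminorm 0 [] f"
proof -
  have "\<forall>k vs. set vs \<subseteq> Basis \<longrightarrow> bdd_above (range (\<lambda>x. norm x ^ k * norm (iter_partial vs f x)))"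
    using assms unfolding schwartz_def mem_Collect_eq by (rule conjunct2)
  then have "bdd_above (range (\<lambda>x. norm x ^ 0 * norm (iter_partial [] f x)))"
    by (metis empty_set empty_subsetI)
  from cSUP_upper[OF UNIV_I this, of x] show ?thesis
    by (simp add: schwartz_seminorm_def)
qed

lemma schwartz_integrable:
  assumes "finite_measure M" and "sets M = sets borel" and f: "f \<in> schwartz"
  shows "integrable M f"
proof -
  interpret finite_measure M by fact
  note [measurable_cong] = \<open>sets M = sets borel\<close>
  have "f \<in> borel_measurable borel"
    using f by (intro borel_measurable_continuous_onI smooth_imp_continuous_on) (simp add: schwartz_def)
  then show ?thesis
    by (intro integrable_const_bound[where B="schwartz_seminorm 0 [] f"])
      (use norm_le_schwartz_seminorm[OF f] in auto)
qed

lemma norm_integral_schwartz_le: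
  assumes "finite_measure M" and sets: "sets M = sets borel" and f: "f \<in> schwartz"
  shows "norm (integral\<^sup>L M f) \<le> measure M UNIV * schwartz_seminorm 0 [] f"
proof -
  interpret finite_measure M by fact
  have "space M = UNIV"
    using sets_eq_imp_space_eq[OF sets] by simp
  moreover have "norm (integral\<^sup>L M f) \<le> (\<integral>x. schwartz_seminorm 0 [] f \<partial>M)"
  proof (rule order_trans[OF integral_norm_bound integral_mono])
    show "integrable M (\<lambda>x. norm (f x))"
      using schwartz_integrable[OF assms] by simp
  qed (use norm_le_schwartz_seminorm[OF f] in auto)
  ultimately show ?thesis
    by simp
qed

text \<open>A finite measure is controlled by the supremum norm, which is the seminorm with k = 0
  and the empty list of derivatives. So N = 0 works, with the sum of the two total masses as
  constant.\<close>

lemma tempered_distribution_signed_integral: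
  assumes dec: "difference_of_measures m P N"
  shows "tempered_distribution (signed_integral m)"
  unfolding tempered_distribution_def
proof (intro conjI ballI allI)
  have fin: "finite_measure P" "finite_measure N" and sets: "sets P = sets borel" "sets N = sets borel"
    using dec by (auto simp: difference_of_measures_def)
  note int = schwartz_integrable[OF fin(1) sets(1)] schwartz_integrable[OF fin(2) sets(2)]
  note eq = signed_integral_eq[OF dec]
  show "signed_integral m (\<lambda>x. f x + g x) = signed_integral m f + signed_integral m g"
    if "f \<in> schwartz" "g \<in> schwartz" for f g
    using int[OF that(1)] int[OF that(2)] by (simp add: eq)
  show "signed_integral m (\<lambda>x. c * f x) = c * signed_integral m f" if "f \<in> schwartz" for c f
    using int[OF that] by (simp add: eq right_diff_distrib)
  have "norm (signed_integral m f) \<le> (measure P UNIV + measure N UNIV) *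
      (\<Sum>k\<le>0. \<Sum>vs\<in>{vs. set vs \<subseteq> Basis \<and> length vs \<le> 0}. schwartz_seminorm k vs f)"
    if f: "f \<in> schwartz" for f
  proof -
    have "{vs. set vs \<subseteq> Basis \<and> length vs \<le> 0} = {[] :: 'a list}"
      by auto
    moreover have "norm (integral\<^sup>L P f - integral\<^sup>L N f) \<le>
        (measure P UNIV + measure N UNIV) * schwartz_seminorm 0 [] f"
      unfolding distrib_right
      by (intro order_trans[OF norm_triangle_ineq4] add_mono norm_integral_schwartz_le fin sets f)
    ultimately show ?thesis
      by (simp add: eq int[OF f])
  qed
  then show "\<exists>C N. \<forall>f\<in>schwartz. norm (signed_integral m f) \<le>
      C * (\<Sum>k\<le>N. \<Sum>vs\<in>{vs. set vs \<subseteq> Basis \<and> length vs \<le> N}. schwartz_seminorm k vs f)"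
    by blast
qed

text \<open>The transform is the difference of those of P and N, and |p - n|^2 \<le> 2|p|^2 + 2|n|^2
  reduces the weighted integral to the two measures separately, without any estimate of their
  interaction.\<close>

lemma signed_integral_H_minus_1:
  fixes m :: "'a::euclidean_space set \<Rightarrow> real"
  assumes dec: "difference_of_measures m P N"
    and energy: "gaussian_energy_bounded P" "gaussian_energy_bounded N"
  shows "signed_integral m \<in> H_minus_1"
proof -
  have fin: "finite_measure P" "finite_measure N" and sets: "sets P = sets borel" "sets N = sets borel"
    using dec by (auto simp: difference_of_measures_def)
  define p n where "p = fourier_measure P" and "n = fourier_measure N"
  have [measurable]: "p \<in> borel_measurable borel" "n \<in> borel_measurable borel"
    unfolding p_def n_def using borel_measurable_fourier_measure fin sets by blast+
  have bound: "norm (p \<xi>) \<le> measure P UNIV" "norm (n \<xi>) \<le> measure N UNIV" for \<xi>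
    unfolding p_def n_def using norm_fourier_measure_le fin sets by blast+
  \<comment> \<open>Bounded Borel multipliers preserve integrability. This serves twice: with the
    indicator of a compact set for local integrability, and with test functions for the
    pairing.\<close>
  have int: "integrable lborel (\<lambda>\<xi>. h \<xi> * f \<xi>)"
    if f: "integrable lborel f" and [measurable]: "h \<in> borel_measurable borel"
      and h: "\<And>\<xi>. norm (h \<xi>) \<le> B" for f h :: "'a \<Rightarrow> complex" and B
  proof (rule Bochner_Integration.integrable_bound)
    show "integrable lborel (\<lambda>\<xi>. of_real B * f \<xi>)"
      using f by simp
    have "norm (h \<xi>) \<le> \<bar>B\<bar>" for \<xi>
      using h[of \<xi>] by linarith
    then show "AE \<xi> in lborel. norm (h \<xi> * f \<xi>) \<le> norm (of_real B * f \<xi>)"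
      by (auto simp: norm_mult intro!: mult_right_mono)
    show "(\<lambda>\<xi>. h \<xi> * f \<xi>) \<in> borel_measurable lborel"
      using f by measurable
  qed
  have "locally_integrable (\<lambda>\<xi>. p \<xi> - n \<xi>)"
    unfolding locally_integrable_def set_integrable_def
  proof (intro allI impI)
    fix K :: "'a set"
    assume "compact K"
    then have "integrable lborel (\<lambda>x. indicator K x *\<^sub>R (1::complex))"
      by (intro borel_integrable_compact) auto
    from int[OF this, of "\<lambda>\<xi>. p \<xi> - n \<xi>" "measure P UNIV + measure N UNIV"]
    show "integrable lborel (\<lambda>\<xi>. indicator K \<xi> *\<^sub>R (p \<xi> - n \<xi>))"
      using bound by (auto simp: scaleR_conv_of_real mult.commute
        intro!: order_trans[OF norm_triangle_ineq4] add_mono)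
  qed
  moreover have "fourier_dist (signed_integral m) f = (\<integral>\<xi>. (p \<xi> - n \<xi>) * f \<xi> \<partial>lborel)"
    if "f \<in> test_functions" for f
  proof -
    note f = test_function_integrable[OF that]
    \<comment> \<open>\<open>signed_integral_eq\<close> requires \<open>fourier f\<close> to be
      integrable against P and N; \<open>integral_fourier\<close> derives this from integrability of
      f.\<close>
    note P = integral_fourier[OF fin(1) sets(1) f] and N = integral_fourier[OF fin(2) sets(2) f]
    have "fourier_dist (signed_integral m) f = (\<integral>\<xi>. p \<xi> * f \<xi> \<partial>lborel) - (\<integral>\<xi>. n \<xi> * f \<xi> \<partial>lborel)"
      unfolding fourier_dist_def signed_integral_eq[OF dec P(1) N(1)] P(2) N(2) p_def n_def ..
    also have "\<dots> = (\<integral>\<xi>. p \<xi> * f \<xi> - n \<xi> * f \<xi> \<partial>lborel)"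
      by (intro Bochner_Integration.integral_diff[symmetric] int[OF f _ bound(1)] int[OF f _ bound(2)]) measurable
    finally show ?thesis
      by (simp add: left_diff_distrib)
  qed
  moreover have "(\<integral>\<^sup>+\<xi>. ennreal ((norm (p \<xi> - n \<xi>))\<^sup>2 / (1 + (norm \<xi>)\<^sup>2)) \<partial>lborel) < \<infinity>"
  proof -
    define E where "E h = (\<integral>\<^sup>+\<xi>. ennreal ((norm (h \<xi>))\<^sup>2 / (1 + (norm \<xi>)\<^sup>2)) \<partial>lborel)" for h :: "'a \<Rightarrow> complex"
    have "E (\<lambda>\<xi>. p \<xi> - n \<xi>) \<le> (\<integral>\<^sup>+\<xi>. 2 * ennreal ((norm (p \<xi>))\<^sup>2 / (1 + (norm \<xi>)\<^sup>2)) +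
        2 * ennreal ((norm (n \<xi>))\<^sup>2 / (1 + (norm \<xi>)\<^sup>2)) \<partial>lborel)"
      unfolding E_def
    proof (rule nn_integral_mono)
      fix \<xi> :: 'a
      have "(norm (p \<xi> - n \<xi>))\<^sup>2 \<le> (norm (p \<xi>) + norm (n \<xi>))\<^sup>2"
        by (intro power_mono norm_triangle_ineq4) auto
      also have "\<dots> \<le> 2 * (norm (p \<xi>))\<^sup>2 + 2 * (norm (n \<xi>))\<^sup>2"
        using sum_squares_bound[of "norm (p \<xi>)" "norm (n \<xi>)"] by (simp add: power2_sum)
      finally have "(norm (p \<xi> - n \<xi>))\<^sup>2 / (1 + (norm \<xi>)\<^sup>2) \<le>
          2 * ((norm (p \<xi>))\<^sup>2 / (1 + (norm \<xi>)\<^sup>2)) + 2 * ((norm (n \<xi>))\<^sup>2 / (1 + (norm \<xi>)\<^sup>2))"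
        by (simp add: divide_right_mono flip: add_divide_distrib)
      then show "ennreal ((norm (p \<xi> - n \<xi>))\<^sup>2 / (1 + (norm \<xi>)\<^sup>2)) \<le>
          2 * ennreal ((norm (p \<xi>))\<^sup>2 / (1 + (norm \<xi>)\<^sup>2)) + 2 * ennreal ((norm (n \<xi>))\<^sup>2 / (1 + (norm \<xi>)\<^sup>2))"
        by (simp add: ennreal_leI flip: ennreal_plus ennreal_mult' ennreal_numeral)
    qed
    also have "\<dots> = 2 * E p + 2 * E n"
      by (simp add: E_def nn_integral_add nn_integral_cmult)
    also have "\<dots> < \<infinity>"
      using fourier_measure_H_minus_1[OF fin(1) sets(1) energy(1)]
        fourier_measure_H_minus_1[OF fin(2) sets(2) energy(2)]
      by (simp add: E_def p_def n_def ennreal_mult_less_top)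
    finally show ?thesis
      by (simp add: E_def)
  qed
  ultimately show ?thesis
    using tempered_distribution_signed_integral[OF dec]
    by (auto simp: H_minus_1_def dist_is_function_def)
qed

section \<open>The two branches of the spiral\<close>

lemma sqrt_branch_pushforward:
  fixes z :: "real \<Rightarrow> complex"
  assumes z: "z \<in> borel_measurable borel" and H: "H \<in> sets borel"
    and norm_z: "\<And>x. x \<in> H \<Longrightarrow> norm (z x) = c * sqrt \<bar>x\<bar>"
    and same_sign: "\<And>x y. x \<in> H \<Longrightarrow> y \<in> H \<Longrightarrow> x * y > 0"
    and "c > 0" "R > 0"
  defines "P \<equiv> distr (density lborel (indicator {x \<in> H. z x \<in> ball 0 R})) borel z"
  shows "finite_measure P"
    and "A \<in> sets borel \<Longrightarrow> measure P A = measure lborel {x \<in> H. z x \<in> A \<inter> ball 0 R}"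
    and "gaussian_energy_bounded P"
proof -
  \<comment> \<open>Distances are estimated through the modulus of z alone, so the rotation of the
    spiral never enters. As H lies on one side of 0, the modulus determines the parameter.\<close>
  define S where "S = {x \<in> H. z x \<in> ball 0 R}"
  note [measurable] = z H
  have S[measurable]: "S \<in> sets borel"
    unfolding S_def mem_ball_0 by measurable
  have sqrt: "sqrt \<bar>x\<bar> < R / c" if "x \<in> S" for x
    using that norm_z[of x] \<open>c > 0\<close> by (simp add: S_def field_simps)
  have "S \<subseteq> cball 0 ((R / c)\<^sup>2)"
  proof
    fix x
    assume "x \<in> S"
    then have "(sqrt \<bar>x\<bar>)\<^sup>2 \<le> (R / c)\<^sup>2"
      by (intro power_mono less_imp_le[OF sqrt]) auto
    then show "x \<in> cball 0 ((R / c)\<^sup>2)"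
      by simp
  qed
  then have "bounded S"
    by (rule bounded_subset[OF bounded_cball])
  then have fin: "emeasure lborel S < \<infinity>"
    by (rule emeasure_bounded_finite)
  have em: "emeasure P A = emeasure lborel {x \<in> H. z x \<in> A \<inter> ball 0 R}" if [measurable]: "A \<in> sets borel" for A
  proof -
    have "emeasure P A = emeasure (density lborel (indicator S)) (z -` A)"
      using that z measurable_sets[OF z that] unfolding P_def S_def[symmetric] by (simp add: emeasure_distr)
    also have "\<dots> = (\<integral>\<^sup>+x. indicator (S \<inter> z -` A) x \<partial>lborel)"
      using measurable_sets[OF z that] by (simp add: emeasure_density indicator_inter_arith)
    also have "\<dots> = emeasure lborel (S \<inter> z -` A)"
      using measurable_sets[OF z that] by (intro nn_integral_indicator) auto
    also have "S \<inter> z -` A = {x \<in> H. z x \<in> A \<inter> ball 0 R}"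
      by (auto simp: S_def)
    finally show ?thesis .
  qed
  show "measure P A = measure lborel {x \<in> H. z x \<in> A \<inter> ball 0 R}" if "A \<in> sets borel"
    using em[OF that] by (simp add: measure_def)
  have "emeasure P UNIV < \<infinity>"
    using em[of UNIV] fin by (simp add: S_def)
  then show "finite_measure P"
    by (intro finite_measureI) (simp add: P_def)
  \<comment> \<open>On S both square roots are below R/c, hence |x - y| is at most 2R/c times the
    difference of the roots. That difference times c is the difference of the moduli, at most the
    distance of the points; together this gives the constant c^2/(2R).\<close>
  have "c\<^sup>2 / (2 * R) * \<bar>x - y\<bar> \<le> dist (z x) (z y)" if "x \<in> S" "y \<in> S" for x y
  proof -
    have xy: "x \<in> H" "y \<in> H"
      using that by (auto simp: S_def)
    have "\<bar>x - y\<bar> = \<bar>\<bar>x\<bar> - \<bar>y\<bar>\<bar>"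
      using same_sign[OF xy] by (auto simp: zero_less_mult_iff)
    also have "\<dots> = \<bar>(sqrt \<bar>x\<bar>)\<^sup>2 - (sqrt \<bar>y\<bar>)\<^sup>2\<bar>"
      by simp
    also have "\<dots> = \<bar>sqrt \<bar>x\<bar> - sqrt \<bar>y\<bar>\<bar> * (sqrt \<bar>x\<bar> + sqrt \<bar>y\<bar>)"
      by (simp only: power2_eq_square square_diff_square_factored abs_mult) (simp add: mult.commute)
    also have "\<dots> \<le> \<bar>sqrt \<bar>x\<bar> - sqrt \<bar>y\<bar>\<bar> * (R / c + R / c)"
      using sqrt[OF that(1)] sqrt[OF that(2)] by (intro mult_left_mono) auto
    finally have "c\<^sup>2 / (2 * R) * \<bar>x - y\<bar> \<le> c\<^sup>2 / (2 * R) * (\<bar>sqrt \<bar>x\<bar> - sqrt \<bar>y\<bar>\<bar> * (R / c + R / c))"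
      using \<open>R > 0\<close> by (intro mult_left_mono) auto
    also have "\<dots> = c * \<bar>sqrt \<bar>x\<bar> - sqrt \<bar>y\<bar>\<bar>"
      using \<open>c > 0\<close> \<open>R > 0\<close> by (simp add: field_simps power2_eq_square)
    also have "\<dots> = \<bar>norm (z x) - norm (z y)\<bar>"
      using \<open>c > 0\<close> norm_z xy by (simp add: abs_mult flip: right_diff_distrib)
    also have "\<dots> \<le> dist (z x) (z y)"
      unfolding dist_norm by (rule norm_triangle_ineq3)
    finally show ?thesis .
  qed
  then show "gaussian_energy_bounded P"
    unfolding P_def S_def[symmetric] using \<open>c > 0\<close> \<open>R > 0\<close>
    by (intro gaussian_energy_bounded_distr[where \<kappa>="c\<^sup>2 / (2 * R)"] z S fin) auto
qed

theorem proposition4p1: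
  fixes b \<mu> p t :: real and k :: int
  assumes "t > 0" and "p * t + 1 \<noteq> 0"
  shows "locally_H_minus_1 (prandtl_measure k b \<mu> p t)"
  unfolding locally_H_minus_1_def
proof (intro allI impI)
  fix R :: real
  assume "R > 0"
  define \<tau>q where "\<tau>q = exp ((1/2 + \<i> * complex_of_real (b * \<mu>)) * log_branch k (p * t + 1))"
  \<comment> \<open>The sign s = 1 or s = -1 selects the branch. Writing the power as an exponential
    of ln |\<Gamma>| gives one Borel function on all of the line; at \<Gamma> = 0 it does not
    vanish, hence the restriction to \<Gamma> \<noteq> 0 in the facts below.\<close>
  define z where "z s \<Gamma> = s * \<tau>q * exp ((1/2 + \<i> * of_real b) * of_real (ln \<bar>\<Gamma>\<bar>))"
    for s :: complex and \<Gamma> :: real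
  have spiral: "prandtl_spiral k b \<mu> p t \<Gamma> = (if \<Gamma> > 0 then z 1 \<Gamma> else z (-1) \<Gamma>)" if "\<Gamma> \<noteq> 0" for \<Gamma>
    using that Ln_of_real[of "- \<Gamma>"]
    by (simp add: prandtl_spiral_def Let_def z_def \<tau>q_def powr_def Ln_of_real)
  have z: "z s \<in> borel_measurable borel" for s
    unfolding z_def by measurable
  \<comment> \<open>The part i b of the exponent contributes only a phase, and the real part 1/2
    gives the square root.\<close>
  have norm_z: "norm (z s \<Gamma>) = norm \<tau>q * sqrt \<bar>\<Gamma>\<bar>" if "norm s = 1" "\<Gamma> \<noteq> 0" for s \<Gamma>
    using that by (simp add: z_def norm_mult powr_half_sqrt[symmetric] powr_def)
  define P where "P s H = distr (density lborel (indicator {x \<in> H. z s x \<in> ball 0 R})) borel (z s)" for s H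
  \<comment> \<open>The constant \<open>norm \<tau>q\<close> is positive since an exponential never
    vanishes, whichever branch k of the logarithm is chosen.\<close>
  note branch = sqrt_branch_pushforward[where R=R and c="norm \<tau>q", OF z _ norm_z, folded P_def]
  have pos: "finite_measure (P 1 {0<..})" "gaussian_energy_bounded (P 1 {0<..})"
    and neg: "finite_measure (P (-1) {..<0})" "gaussian_energy_bounded (P (-1) {..<0})"
    by (intro branch; use \<open>R > 0\<close> in \<open>auto simp: \<tau>q_def mult_neg_neg\<close>)+
  have meas: "measure (P 1 {0<..}) A = measure lborel {x \<in> {0<..}. z 1 x \<in> A \<inter> ball 0 R}"
    "measure (P (-1) {..<0}) A = measure lborel {x \<in> {..<0}. z (-1) x \<in> A \<inter> ball 0 R}"
    if "A \<in> sets borel" for A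
    by (intro branch; use that \<open>R > 0\<close> in \<open>auto simp: \<tau>q_def mult_neg_neg\<close>)+
  have "prandtl_measure k b \<mu> p t (A \<inter> ball 0 R) = measure (P 1 {0<..}) A - measure (P (-1) {..<0}) A"
    if "A \<in> sets borel" for A
  proof -
    have "{\<Gamma>. \<Gamma> > 0 \<and> prandtl_spiral k b \<mu> p t \<Gamma> \<in> A \<inter> ball 0 R} = {x \<in> {0<..}. z 1 x \<in> A \<inter> ball 0 R}"
      "{\<Gamma>. \<Gamma> < 0 \<and> prandtl_spiral k b \<mu> p t \<Gamma> \<in> A \<inter> ball 0 R} = {x \<in> {..<0}. z (-1) x \<in> A \<inter> ball 0 R}"
      using spiral by auto
    then show ?thesis
      unfolding prandtl_measure_def meas[OF that] by simp
  qed
  then have dec: "difference_of_measures (\<lambda>A. prandtl_measure k b \<mu> p t (A \<inter> ball 0 R)) (P 1 {0<..}) (P (-1) {..<0})"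
    using pos neg by (simp add: difference_of_measures_def P_def)
  show "finite_signed_measure (\<lambda>A. prandtl_measure k b \<mu> p t (A \<inter> ball 0 R)) \<and>
      signed_integral (\<lambda>A. prandtl_measure k b \<mu> p t (A \<inter> ball 0 R)) \<in> H_minus_1"
    using difference_of_measures_imp_finite_signed_measure[OF dec]
      signed_integral_H_minus_1[OF dec pos(2) neg(2)] by blast
qed

end
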